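(* Let $n=n_d\ge1$, $\alpha=\alpha_d>0$, $1\le s=s_d\le d$, $a=a_d>0$ depend on $d$. Assume that, as $d\to\infty$, $\alpha/d\to0$, $n\alpha^2/d^2\to+\infty$ and $\sigma d/(\sqrt n\,\alpha)\ll a\le2\sigma$. Let $\hat\eta^+$ be the selector with components $\hat\eta^+_j=I\bigl(\frac1n\sum_{i=1}^nZ^i_j\ge\tau\bigr)$, $j=1,\dots,d$, with $\tau=p(2)a/\sigma$. Then for $d$ large enough $$\sup_{\theta\in\Theta_d^+(s,a)}\frac1s\mathbb{E}|\hat\eta^+-\eta|\le2\exp\Bigl(\log\Bigl(\frac ds\Bigr)-\frac{p^2(2)\,a^2n\alpha^2}{2^9\sigma^2d^2}\Bigr).$$ In particular, if $a\gg\frac{\sigma d}{\alpha\sqrt n}\log^{1/2}(d/s)$, then $\sup_{\theta\in\Theta_d^+(s,a)}\frac1s\mathbb{E}|\hat\eta^+-\eta|\to0$ as $d\to\infty$. Moreover, if $a\gg\frac{\sigma d}{\alpha\sqrt n}\log^{1/2}(d)$, then $\sup_{\theta\in\Theta_d^+(s,a)}\mathbb{E}|\hat\eta^+-\eta|\to0$ as $d\to\infty$.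
   Context: Notation: $a_d\gg b_d$ means $a_d/b_d\to\infty$ as $d\to\infty$. Model: $\sigma>0$, $\theta\in\mathbb{R}^d$; $X^1,\dots,X^n$ are i.i.d. random vectors in $\mathbb{R}^d$, $X^i=\theta+\sigma\xi^i$, where $\xi^i$ has i.i.d. coordinates whose common law on $\mathbb{R}$ (not depending on $d$) is symmetric around $0$, has variance $1$ and is $c$-strongly log-concave for a constant $c>0$: it has density $p(x)=\exp(-\phi_0(x))\exp(-cx^2/2)$ with $\phi_0:\mathbb{R}\to\mathbb{R}$ a finite even convex function. $p(2)$ is the value of this density at $2$. $\Theta_d^+(s,a)$ is the set of $\theta\in\mathbb{R}^d$ for which there is $S\subseteq\{1,\dots,d\}$ with at most $s$ elements such that $\theta_j\ge a$ for $j\in S$ and $\theta_j=0$ for $j\notin S$. Put $\eta=(I(\theta_j\ne0))_{j=1,\dots,d}$ and $|\hat\eta-\eta|=\sum_{j=1}^d I(\hat\eta_j\neq\eta_j)$. Privatized data (Laplace mechanism): $Z^i_j=\mathrm{sgn}[X^i_j]+\frac{2d}{\alpha}W^i_j$, $i=1,\dots,n$, $j=1,\dots,d$, where $\mathrm{sgn}[x]=1$ for $x\ge0$ and $\mathrm{sgn}[x]=-1$ for $x<0$, and the $W^i_j$ are i.i.d. Laplace$(1)$ variables (density $\frac12e^{-|x|}$), independent of the $X^i$. Expectations are over the joint law of the $X^i$ and $W^i_j$. *)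

theory Defs
  imports "HOL-Probability.Probability"
begin

text \<open>The notation \<open>f \<gg> g\<close>, that is \<open>f d / g d \<rightarrow> \<infinity>\<close>. The quotient is taken in the extended
  reals, where a positive number divided by \<open>0\<close> is \<open>\<infinity>\<close>; this matters for the rate
  \<open>log(d/s)\<close>, which vanishes when \<open>s = d\<close>.\<close>

definition much_greater :: "(nat \<Rightarrow> real) \<Rightarrow> (nat \<Rightarrow> real) \<Rightarrow> bool"  (infix "\<ggreater>" 50) where
  "f \<ggreater> g \<longleftrightarrow> ((\<lambda>d. ereal (f d) / ereal (g d)) \<longlongrightarrow> \<infinity>) sequentially"

definition symmetric_strongly_log_concave :: "real \<Rightarrow> (real \<Rightarrow> real) \<Rightarrow> bool" where
  "symmetric_strongly_log_concave c p \<longleftrightarrow>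
     (\<exists>\<phi>0. convex_on UNIV \<phi>0 \<and> (\<forall>x. \<phi>0 (- x) = \<phi>0 x) \<and>
           (\<forall>x. p x = exp (- \<phi>0 x) * exp (- c * x\<^sup>2 / 2)))"

definition laplace_density :: "real \<Rightarrow> real" where
  "laplace_density x = exp (- \<bar>x\<bar>) / 2"

text \<open>Vectors in \<open>\<real>\<^sup>d\<close> are extensional functions on \<open>{1..d}\<close>.\<close>

definition Theta_plus :: "nat \<Rightarrow> nat \<Rightarrow> real \<Rightarrow> (nat \<Rightarrow> real) set" where
  "Theta_plus d s a =
     {\<theta> \<in> {1..d} \<rightarrow>\<^sub>E UNIV.
        \<exists>S \<subseteq> {1..d}. card S \<le> s \<and> (\<forall>j\<in>S. a \<le> \<theta> j) \<and> (\<forall>j\<in>{1..d} - S. \<theta> j = 0)}"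

definition support_pattern :: "(nat \<Rightarrow> real) \<Rightarrow> nat \<Rightarrow> nat" where
  "support_pattern \<theta> j = of_bool (\<theta> j \<noteq> 0)"

definition hamming :: "nat \<Rightarrow> (nat \<Rightarrow> nat) \<Rightarrow> (nat \<Rightarrow> nat) \<Rightarrow> nat" where
  "hamming d h e = (\<Sum>j=1..d. of_bool (h j \<noteq> e j))"

text \<open>Unlike the library's \<^const>\<open>sgn\<close>, this sign takes the value \<open>1\<close> at \<open>0\<close>.\<close>

definition sign_pm :: "real \<Rightarrow> real" where
  "sign_pm x = (if 0 \<le> x then 1 else - 1)"

text \<open>In families of random variables such as \<open>\<xi> i j\<close>, the first index is the observation
  \<open>i \<in> {1..n}\<close> and the second one the coordinate \<open>j \<in> {1..d}\<close>.\<close>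

definition observation ::
  "real \<Rightarrow> (nat \<Rightarrow> real) \<Rightarrow> (nat \<Rightarrow> nat \<Rightarrow> 'w \<Rightarrow> real) \<Rightarrow> nat \<Rightarrow> nat \<Rightarrow> 'w \<Rightarrow> real" where
  "observation \<sigma> \<theta> \<xi> i j \<omega> = \<theta> j + \<sigma> * \<xi> i j \<omega>"

definition privatized ::
  "nat \<Rightarrow> real \<Rightarrow> (nat \<Rightarrow> nat \<Rightarrow> 'w \<Rightarrow> real) \<Rightarrow> (nat \<Rightarrow> nat \<Rightarrow> 'w \<Rightarrow> real)
     \<Rightarrow> nat \<Rightarrow> nat \<Rightarrow> 'w \<Rightarrow> real" where
  "privatized d \<alpha> X W i j \<omega> = sign_pm (X i j \<omega>) + (2 * real d / \<alpha>) * W i j \<omega>"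

definition selector_plus ::
  "nat \<Rightarrow> real \<Rightarrow> (nat \<Rightarrow> nat \<Rightarrow> 'w \<Rightarrow> real) \<Rightarrow> nat \<Rightarrow> 'w \<Rightarrow> nat" where
  "selector_plus n \<tau> Z j \<omega> = of_bool ((1 / real n) * (\<Sum>i=1..n. Z i j \<omega>) \<ge> \<tau>)"

text \<open>\<open>E|\<eta>\<^sup>+ - \<eta>|\<close> for the selector with threshold \<open>\<tau>\<close>. It lies in \<open>[0, d]\<close>, so its supremum
  over a nonempty set of \<open>\<theta>\<close> may be taken in the reals.\<close>

definition selector_risk ::
  "'w measure \<Rightarrow> nat \<Rightarrow> nat \<Rightarrow> real \<Rightarrow> real \<Rightarrow> real \<Rightarrow>
   (nat \<Rightarrow> nat \<Rightarrow> 'w \<Rightarrow> real) \<Rightarrow> (nat \<Rightarrow> nat \<Rightarrow> 'w \<Rightarrow> real) \<Rightarrow> (nat \<Rightarrow> real) \<Rightarrow> real" where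
  "selector_risk M d n \<alpha> \<sigma> \<tau> \<xi> W \<theta> =
     prob_space.expectation M (\<lambda>\<omega>. real (hamming d
       (\<lambda>j. selector_plus n \<tau> (privatized d \<alpha> (observation \<sigma> \<theta> \<xi>) W) j \<omega>)
       (support_pattern \<theta>)))"

end

theory Submission
  imports Defs
begin

text \<open>Write \<open>L = 2d/\<alpha>\<close> for the scale of the Laplace noise. If \<open>\<theta>\<^sub>j = 0\<close>, then \<open>sgn X\<^sup>i\<^sub>j\<close> has mean
  \<open>0\<close> by symmetry. If \<open>\<theta>\<^sub>j \<ge> a\<close>, then its mean is \<open>P(\<bar>\<xi>\<bar> \<le> \<theta>\<^sub>j/\<sigma>) \<ge> 2 p(2) a/\<sigma> = 2\<tau>\<close>, because \<open>p\<close>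
  decreases with \<open>\<bar>x\<bar>\<close> and \<open>a/\<sigma> \<le> 2\<close>. So in both cases a wrong decision in coordinate \<open>j\<close> is a
  deviation by \<open>\<tau>\<close> of the empirical mean, and Chernoff's bound with the parameter \<open>\<tau>/(8L\<^sup>2)\<close> gives
  it probability at most \<open>exp(-n\<tau>\<^sup>2/(128L\<^sup>2))\<close> as soon as \<open>L \<ge> max 1 (p 2)\<close>. Summing over the \<open>d\<close>
  coordinates gives the risk bound, whose exponent is a constant times \<open>(a \<surd>n \<alpha>/(\<sigma>d))\<^sup>2\<close>.\<close>

section \<open>Chernoff bound for two jointly independent families\<close>

text \<open>Markov's inequality for \<open>exp S\<close>, whose expectation factorises by
  independence. The Chernoff parameter is absorbed into \<open>f\<close> and \<open>g\<close>, and
  the two families keep separate bounds \<open>A\<close> and \<open>B\<close> because sign and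
  Laplace noise are estimated differently.\<close>

lemma (in prob_space) chernoff_indep_sum:
  fixes X Y :: "'i \<Rightarrow> 'a \<Rightarrow> real" and f g :: "real \<Rightarrow> real"
  assumes I: "finite I"
    and indep: "indep_vars (\<lambda>_. borel) (case_sum X Y) (I <+> I)"
    and [measurable]: "f \<in> borel_measurable borel" "g \<in> borel_measurable borel"
    and intX: "\<And>i. i \<in> I \<Longrightarrow> integrable M (\<lambda>\<omega>. exp (f (X i \<omega>)))"
    and intY: "\<And>i. i \<in> I \<Longrightarrow> integrable M (\<lambda>\<omega>. exp (g (Y i \<omega>)))"
    and X_le: "\<And>i. i \<in> I \<Longrightarrow> expectation (\<lambda>\<omega>. exp (f (X i \<omega>))) \<le> A"
    and Y_le: "\<And>i. i \<in> I \<Longrightarrow> expectation (\<lambda>\<omega>. exp (g (Y i \<omega>))) \<le> B"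
  shows "prob {\<omega> \<in> space M. (\<Sum>i\<in>I. f (X i \<omega>) + g (Y i \<omega>)) \<ge> t} \<le> exp (- t) * (A * B) ^ card I"
proof -
  \<comment> \<open>Indexing the factors of both families by the disjoint union lets a single
    independence statement cover all of them; their product is
    \<open>exp (S \<omega>)\<close>.\<close>
  define F where [abs_def]: "F k \<omega> = exp (case_sum (\<lambda>_. f) (\<lambda>_. g) k (case_sum X Y k \<omega>))" for k \<omega>
  have F: "indep_vars (\<lambda>_. borel) F (I <+> I)"
    unfolding F_def
    by (rule indep_vars_compose2[OF indep, where Y = "\<lambda>k x. exp (case_sum (\<lambda>_. f) (\<lambda>_. g) k x)"])
      (auto split: sum.split)
  have intF: "integrable M (F k)" if "k \<in> I <+> I" for k
    using that intX intY by (auto simp: F_def)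
  have rvX [measurable]: "random_variable borel (X i)" if "i \<in> I" for i
    using indep that unfolding indep_vars_def by (auto dest: bspec[where x = "Inl i"])
  have rvY [measurable]: "random_variable borel (Y i)" if "i \<in> I" for i
    using indep that unfolding indep_vars_def by (auto dest: bspec[where x = "Inr i"])
  define S where "S \<omega> = (\<Sum>i\<in>I. f (X i \<omega>) + g (Y i \<omega>))" for \<omega>
  have [measurable]: "S \<in> borel_measurable M"
    unfolding S_def by measurable
  have prod_F: "(\<Prod>k\<in>I <+> I. F k \<omega>) = exp (S \<omega>)" for \<omega>
    using I by (simp add: prod.Plus F_def S_def exp_sum exp_add prod.distrib)
  have int: "integrable M (\<lambda>\<omega>. exp (S \<omega>))"
    using indep_vars_integrable[OF _ F intF] I by (simp add: prod_F)
  have "expectation (\<lambda>\<omega>. exp (S \<omega>)) = (\<Prod>k\<in>I <+> I. expectation (F k))"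
    using indep_vars_lebesgue_integral[OF _ F intF] I by (simp add: prod_F)
  also have "\<dots> = (\<Prod>i\<in>I. expectation (\<lambda>\<omega>. exp (f (X i \<omega>))) * expectation (\<lambda>\<omega>. exp (g (Y i \<omega>))))"
    using I by (simp add: prod.Plus F_def prod.distrib)
  also have "\<dots> \<le> (\<Prod>i\<in>I. A * B)"
    \<comment> \<open>The side condition \<open>0 \<le> A\<close> holds because \<open>A\<close>
      dominates the expectation of an exponential.\<close>
    by (intro prod_mono conjI mult_mono X_le Y_le mult_nonneg_nonneg)
      (auto intro: order_trans[OF _ X_le])
  finally have exp_S: "expectation (\<lambda>\<omega>. exp (S \<omega>)) \<le> (A * B) ^ card I"
    by simp
  have "prob {\<omega> \<in> space M. S \<omega> \<ge> t} = expectation (indicator {\<omega> \<in> space M. S \<omega> \<ge> t})"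
    by simp
  also have "\<dots> \<le> expectation (\<lambda>\<omega>. exp (- t) * exp (S \<omega>))"
  proof (rule integral_mono)
    show "integrable M (\<lambda>\<omega>. exp (- t) * exp (S \<omega>))"
      using int by (rule integrable_mult_right)
  qed (auto intro!: integrable_real_indicator split: split_indicator simp: emeasure_eq_measure simp flip: exp_add)
  also have "\<dots> \<le> exp (- t) * (A * B) ^ card I"
    using exp_S by simp
  finally show ?thesis
    by (simp add: S_def)
qed

section \<open>The moment generating function of the Laplace law\<close>

lemma exponential_density_integral:
  assumes "0 < l"
  shows "integrable lborel (exponential_density l)" "integral\<^sup>L lborel (exponential_density l) = 1"
proof -
  interpret prob_space "density lborel (exponential_density l)"
    using assms by (rule prob_space_exponential_density)
  have nn: "(\<integral>\<^sup>+ x. ennreal (exponential_density l x) \<partial>lborel) = 1"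
    using emeasure_space_1 by (simp add: emeasure_density)
  then have "has_bochner_integral lborel (exponential_density l) 1"
    using assms by (intro has_bochner_integral_nn_integral) (auto simp: exponential_density_nonneg)
  then show "integrable lborel (exponential_density l)" "integral\<^sup>L lborel (exponential_density l) = 1"
    by (auto simp: has_bochner_integral_iff)
qed

text \<open>Tilting the Laplace density by \<open>exp (u * x)\<close> leaves an exponential density
  of rate \<open>1 - u\<close> on the right half-line and a reflected one of rate
  \<open>1 + u\<close> on the left, with weights \<open>1 / (2 * (1 - u))\<close> and
  \<open>1 / (2 * (1 + u))\<close>. The value is the sum of the weights.\<close>

lemma laplace_mgf:
  assumes u: "\<bar>u\<bar> < 1"
  shows "has_bochner_integral lborel (\<lambda>x. laplace_density x * exp (u * x)) (1 / (1 - u\<^sup>2))"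
proof -
  have expd: "has_bochner_integral lborel (exponential_density l) 1" if "0 < l" for l
    using exponential_density_integral[OF that] by (simp add: has_bochner_integral_iff)
  have refl: "has_bochner_integral lborel (\<lambda>x. exponential_density l (- x)) 1" if "0 < l" for l
    using expd[OF that] lborel_has_bochner_integral_real_affine_iff[of "-1" "exponential_density l" 1 0]
    by simp
  have "has_bochner_integral lborel
      (\<lambda>x. 1 / (2 * (1 - u)) * exponential_density (1 - u) x
         + 1 / (2 * (1 + u)) * exponential_density (1 + u) (- x))
      (1 / (2 * (1 - u)) * 1 + 1 / (2 * (1 + u)) * 1)"
    using u by (intro has_bochner_integral_add has_bochner_integral_mult_right expd refl) auto
  also have "1 / (2 * (1 - u)) * 1 + 1 / (2 * (1 + u)) * 1 = 1 / (1 - u\<^sup>2)"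
  proof -
    have "1 - u \<noteq> 0" "1 + u \<noteq> 0" "1 - u\<^sup>2 = (1 - u) * (1 + u)"
      using u by (auto simp: algebra_simps power2_eq_square)
    then show ?thesis
      by (simp only: \<open>1 - u\<^sup>2 = _\<close>) (simp add: divide_simps, simp add: algebra_simps)
  qed
  finally have *: "has_bochner_integral lborel
      (\<lambda>x. 1 / (2 * (1 - u)) * exponential_density (1 - u) x
         + 1 / (2 * (1 + u)) * exponential_density (1 + u) (- x)) (1 / (1 - u\<^sup>2))" .
  have cancel: "1 / (2 * c) * (c * z) = z / 2" if "c \<noteq> 0" for c z :: real
    using that by simp
  \<comment> \<open>At \<open>0\<close> both exponential densities are positive and the
    decomposition counts the point twice, so the identity holds only almost everywhere.\<close>
  have "AE x in lborel. x \<noteq> (0::real)"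
    by (rule AE_lborel_singleton)
  then have "AE x in lborel. 1 / (2 * (1 - u)) * exponential_density (1 - u) x
         + 1 / (2 * (1 + u)) * exponential_density (1 + u) (- x) = laplace_density x * exp (u * x)"
  proof eventually_elim
    case (elim x)
    consider "x < 0" | "x > 0"
      using elim by linarith
    moreover have "1 - u \<noteq> 0" "1 + u \<noteq> 0"
      using u by auto
    ultimately show ?case
    proof cases
      case 1
      have "1 / (2 * (1 + u)) * exponential_density (1 + u) (- x) =
          1 / (2 * (1 + u)) * ((1 + u) * exp (x * (1 + u)))"
        using 1 by (simp add: exponential_density_def)
      also have "\<dots> = exp (x * (1 + u)) / 2"
        using \<open>1 + u \<noteq> 0\<close> by (rule cancel)
      finally have "1 / (2 * (1 + u)) * exponential_density (1 + u) (- x) = exp (x * (1 + u)) / 2" .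
      with 1 show ?thesis
        by (simp add: exponential_density_def laplace_density_def algebra_simps flip: exp_add)
    next
      case 2
      have "1 / (2 * (1 - u)) * exponential_density (1 - u) x =
          1 / (2 * (1 - u)) * ((1 - u) * exp (- x * (1 - u)))"
        using 2 by (simp add: exponential_density_def)
      also have "\<dots> = exp (- x * (1 - u)) / 2"
        using \<open>1 - u \<noteq> 0\<close> by (rule cancel)
      finally have "1 / (2 * (1 - u)) * exponential_density (1 - u) x = exp (- x * (1 - u)) / 2" .
      with 2 show ?thesis
        by (simp add: exponential_density_def laplace_density_def algebra_simps flip: exp_add)
    qed
  qed
  then show ?thesis
    using * by (subst (asm) has_bochner_integral_cong_AE) (auto simp: laplace_density_def)
qed

lemma laplace_mgf_le:
  fixes u :: real
  assumes "u\<^sup>2 \<le> 1 / 2"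
  shows "1 / (1 - u\<^sup>2) \<le> exp (2 * u\<^sup>2)"
proof -
  \<comment> \<open>This product is exactly the excess of \<open>(1 + 2 * u^2) * (1 - u^2)\<close>
    over \<open>1\<close>.\<close>
  have "0 \<le> u\<^sup>2 * (1 - 2 * u\<^sup>2)"
    using assms by (intro mult_nonneg_nonneg) auto
  then have "1 \<le> (1 + 2 * u\<^sup>2) * (1 - u\<^sup>2)"
    by (simp add: algebra_simps)
  then have "1 / (1 - u\<^sup>2) \<le> 1 + 2 * u\<^sup>2"
    using assms by (simp add: divide_simps)
  also have "\<dots> \<le> exp (2 * u\<^sup>2)"
    by (rule exp_ge_add_one_self)
  finally show ?thesis .
qed

section \<open>Hyperbolic estimates and the exponential of a sign\<close>

text \<open>Average the bound \<open>exp y \<le> 1 + y + y^2\<close> over \<open>y = x\<close> and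
  \<open>y = - x\<close>. For negative \<open>y\<close> it comes from inverting the quadratic Taylor
  lower bound of \<open>exp (- y)\<close>.\<close>

lemma cosh_le_one_plus_square:
  fixes x :: real
  assumes "\<bar>x\<bar> \<le> 1"
  shows "cosh x \<le> 1 + x\<^sup>2"
proof -
  have "exp y \<le> 1 + y + y\<^sup>2" if "\<bar>y\<bar> \<le> 1" for y :: real
  proof (cases "0 \<le> y")
    case True
    then show ?thesis using exp_bound[of y] that by simp
  next
    case False
    define z where "z = - y"
    have z: "0 \<le> z" "z \<le> 1" using False that by (auto simp: z_def)
    have "1 + z + z\<^sup>2 / 2 \<le> exp z"
      using exp_lower_Taylor_quadratic[OF z(1)] by simp
    moreover have "1 \<le> (1 + z + z\<^sup>2 / 2) * (1 - z + z\<^sup>2)"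
    proof -
      have "(1 + z + z\<^sup>2 / 2) * (1 - z + z\<^sup>2) = 1 + z\<^sup>2 / 2 + z ^ 3 / 2 + z ^ 4 / 2"
        by (simp add: field_simps power2_eq_square power3_eq_cube power4_eq_xxxx)
      then show ?thesis using z by simp
    qed
    moreover have "0 \<le> 1 - z + z\<^sup>2" using z by simp
    ultimately have "1 \<le> exp z * (1 - z + z\<^sup>2)"
      by (meson mult_right_mono order_trans)
    then have "exp (- z) \<le> 1 - z + z\<^sup>2"
      by (simp add: exp_minus field_simps)
    then show ?thesis by (simp add: z_def)
  qed
  from this[of x] this[of "- x"] show ?thesis
    using assms by (simp add: cosh_def)
qed

lemma le_sinh:
  fixes x :: real
  assumes "0 \<le> x"
  shows "x \<le> sinh x"
proof -
  have "sinh 0 - 0 \<le> sinh x - x"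
    by (rule DERIV_nonneg_imp_nondecreasing[OF assms])
      (auto intro!: derivative_eq_intros exI cosh_real_ge_1)
  then show ?thesis by simp
qed

lemma sign_pm_measurable [measurable]: "sign_pm \<in> borel_measurable borel"
  unfolding sign_pm_def by measurable

text \<open>A function on \<open>{-1, 1}\<close> is affine, so the moment generating function of a
  random sign is determined by its mean alone.\<close>

lemma exp_sign_pm: "exp (u * sign_pm x) = cosh u + sinh u * sign_pm x"
  by (simp add: sign_pm_def cosh_def sinh_def field_simps)

section \<open>The noise density and the mean of a shifted sign\<close>

lemma symmetric_strongly_log_concaveD:
  assumes p: "symmetric_strongly_log_concave c p" and c: "0 < c"
  shows "p \<in> borel_measurable borel" "p (- x) = p x" "0 < p x" "\<bar>x\<bar> \<le> y \<Longrightarrow> p y \<le> p x"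
proof -
  obtain \<phi> where conv: "convex_on UNIV \<phi>" and sym: "\<And>x. \<phi> (- x) = \<phi> x"
    and p_eq: "\<And>x. p x = exp (- \<phi> x) * exp (- c * x\<^sup>2 / 2)"
    using p unfolding symmetric_strongly_log_concave_def by blast
  \<comment> \<open>Measurability of \<open>p\<close> comes from convexity: a finite convex function
    on the whole line is continuous.\<close>
  have "continuous_on UNIV \<phi>"
    using conv by (intro convex_on_continuous) auto
  then have [measurable]: "\<phi> \<in> borel_measurable borel"
    by (rule borel_measurable_continuous_onI)
  have "p = (\<lambda>x. exp (- \<phi> x) * exp (- c * x\<^sup>2 / 2))"
    using p_eq by auto
  then show "p \<in> borel_measurable borel"
    by simp
  show "p (- x) = p x" "0 < p x"
    by (simp_all add: p_eq sym)
  assume xy: "\<bar>x\<bar> \<le> y"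
  \<comment> \<open>\<open>x\<close> lies in the interval from \<open>- y\<close> to
    \<open>y\<close>, where a convex function is at most its larger endpoint value; by evenness the
    two endpoint values agree.\<close>
  have "\<phi> x \<le> max (\<phi> (- y)) (\<phi> y)"
    using xy by (intro convex_on_le_max) (auto intro: convex_on_subset[OF conv])
  moreover have "c * x\<^sup>2 \<le> c * y\<^sup>2"
    using xy c power_mono[of "\<bar>x\<bar>" y 2] by simp
  ultimately show "p y \<le> p x"
    by (simp add: p_eq sym flip: exp_add)
qed

text \<open>With the odd function \<open>sgn\<close> the integrand is odd, so reflection shows that
  the integral equals its own negative. \<open>sign_pm\<close> differs from \<open>sgn\<close> only
  at \<open>0\<close>, a null set.\<close>

lemma integral_sign_symmetric:
  fixes p :: "real \<Rightarrow> real"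
  assumes [measurable]: "p \<in> borel_measurable borel"
    and sym: "\<And>x. p (- x) = p x" and \<sigma>: "0 < \<sigma>"
  shows "(\<integral>x. p x * sign_pm (\<sigma> * x) \<partial>lborel) = 0"
proof -
  have "(\<integral>x. p x * sgn x \<partial>lborel) = - (\<integral>x. p x * sgn x \<partial>lborel)"
    using lborel_integral_real_affine[of "-1" "\<lambda>x. p x * sgn x" 0] by (simp add: sym)
  moreover have "(\<integral>x. p x * sign_pm (\<sigma> * x) \<partial>lborel) = (\<integral>x. p x * sgn x \<partial>lborel)"
  proof (rule integral_cong_AE)
    show "AE x in lborel. p x * sign_pm (\<sigma> * x) = p x * sgn x"
      using AE_lborel_singleton[of 0]
      by eventually_elim (use \<sigma> in \<open>auto simp: sign_pm_def zero_le_mult_iff sgn_if\<close>)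
  qed auto
  ultimately show ?thesis by simp
qed

text \<open>Shifting by \<open>t \<ge> a\<close> never lowers the sign and raises it from
  \<open>-1\<close> to \<open>1\<close> on \<open>[-a/\<sigma>, 0)\<close>. This interval has length
  \<open>a / \<sigma> \<le> b\<close>, and \<open>p\<close> is at least \<open>p b\<close> on
  it.\<close>

lemma integral_sign_shift_ge:
  fixes p :: "real \<Rightarrow> real"
  assumes [measurable]: "p \<in> borel_measurable borel" and int: "integrable lborel p"
    and sym: "\<And>x. p (- x) = p x" and nonneg: "\<And>x. 0 \<le> p x"
    and mono: "\<And>x. \<bar>x\<bar> \<le> b \<Longrightarrow> p b \<le> p x"
    and \<sigma>: "0 < \<sigma>" and a: "0 \<le> a" "a \<le> b * \<sigma>" "a \<le> t"
  shows "2 * (p b * a / \<sigma>) \<le> (\<integral>x. p x * sign_pm (t + \<sigma> * x) \<partial>lborel)"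
proof -
  have int_sign: "integrable lborel (\<lambda>x. p x * sign_pm (r + \<sigma> * x))" for r
    by (rule Bochner_Integration.integrable_bound[OF int]) (auto simp: sign_pm_def)
  define J where "J = {- (a / \<sigma>)..<0}"
  have [measurable]: "J \<in> sets borel" by (simp add: J_def)
  have "2 * (p b * a / \<sigma>) = (\<integral>x. 2 * p b * indicator J x \<partial>lborel)"
    using a(1) \<sigma> by (simp add: J_def)
  \<comment> \<open>The subtracted unshifted term integrates to \<open>0\<close> by symmetry; it
    makes the comparison pointwise.\<close>
  also have "\<dots> \<le> (\<integral>x. p x * sign_pm (t + \<sigma> * x) - p x * sign_pm (0 + \<sigma> * x) \<partial>lborel)"
  proof (rule integral_mono)
    have "emeasure lborel J < \<infinity>"
      using a(1) \<sigma> by (simp add: J_def)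
    then show "integrable lborel (\<lambda>x. 2 * p b * indicator J x)"
      by (intro integrable_mult_right integrable_real_indicator) auto
    show "2 * p b * indicator J x \<le> p x * sign_pm (t + \<sigma> * x) - p x * sign_pm (0 + \<sigma> * x)" for x
    proof (cases "x \<in> J")
      case True
      then have x: "- a \<le> \<sigma> * x" "\<sigma> * x < 0"
        using \<sigma> by (auto simp: J_def field_simps mult_less_0_iff)
      then have "- (b * \<sigma>) \<le> \<sigma> * x" using a(2) by linarith
      then have "\<sigma> * (- b) \<le> \<sigma> * x" by (simp add: mult.commute)
      then have "\<bar>x\<bar> \<le> b"
        using \<sigma> x(2) mult_le_cancel_left_pos[OF \<sigma>, of "- b" x] True by (auto simp: J_def)
      then show ?thesis
        using mono[of x] x a(3) True by (auto simp: sign_pm_def)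
    next
      case False
      have "sign_pm (0 + \<sigma> * x) \<le> sign_pm (t + \<sigma> * x)"
        using a by (auto simp: sign_pm_def)
      then show ?thesis
        using False nonneg[of x] by (simp add: mult_left_mono)
    qed
  qed (intro Bochner_Integration.integrable_diff int_sign)
  also have "\<dots> = (\<integral>x. p x * sign_pm (t + \<sigma> * x) \<partial>lborel)"
    using integral_sign_symmetric[of p \<sigma>] sym \<sigma> int_sign[of t] int_sign[of 0]
    by (subst Bochner_Integration.integral_diff) auto
  finally show ?thesis .
qed

section \<open>Error probability in a single coordinate\<close>

lemma (in prob_space) coordinate_error:
  fixes \<xi> W :: "nat \<Rightarrow> nat \<Rightarrow> 'a \<Rightarrow> real" and \<theta> :: "nat \<Rightarrow> real"
    and \<alpha> \<sigma> \<tau> :: real and d n j :: nat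
  defines "err \<equiv> {\<omega> \<in> space M. selector_plus n \<tau> (privatized d \<alpha> (observation \<sigma> \<theta> \<xi>) W) j \<omega>
                                 \<noteq> support_pattern \<theta> j}"
  assumes p: "symmetric_strongly_log_concave c p" and c: "0 < c" and \<sigma>: "0 < \<sigma>"
    and lawX: "\<And>i. i \<in> {1..n} \<Longrightarrow> distributed M lborel (\<xi> i j) p"
    and lawW: "\<And>i. i \<in> {1..n} \<Longrightarrow> distributed M lborel (W i j) laplace_density"
    and indep: "indep_vars (\<lambda>_. borel) (case_sum (\<lambda>(i, j). \<xi> i j) (\<lambda>(i, j). W i j))
                  (({1..n} \<times> {1..d}) <+> ({1..n} \<times> {1..d}))"
    and n: "1 \<le> n" and j: "j \<in> {1..d}" and a: "0 < a" "a \<le> 2 * \<sigma>"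
    and L: "1 \<le> 2 * real d / \<alpha>" "p 2 \<le> 2 * real d / \<alpha>"
    and \<theta>: "\<theta> j = 0 \<or> a \<le> \<theta> j" and \<tau>: "\<tau> = p 2 * a / \<sigma>"
  shows "err \<in> events" "prob (err) \<le> exp (- (real n * \<tau>\<^sup>2 / (128 * (2 * real d / \<alpha>)\<^sup>2)))"
proof -
  define L where "L = 2 * real d / \<alpha>"
  \<comment> \<open>The exponent per observation will be at most
    \<open>3 * (l * L)^2 - l * \<tau>\<close>, which is minimal at
    \<open>l = \<tau> / (6 * L^2)\<close>; the factor \<open>8\<close> is close to that and gives
    round numbers.\<close>
  define l where "l = \<tau> / (8 * L\<^sup>2)"
  \<comment> \<open>The sign of the deviation that leads to an error: upwards off the support, downwards on it.\<close>
  define e :: real where "e = (if \<theta> j = 0 then 1 else - 1)"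
  define Y where "Y i \<omega> = sign_pm (\<theta> j + \<sigma> * \<xi> i j \<omega>) + L * W i j \<omega>" for i \<omega>
  note p_props = symmetric_strongly_log_concaveD[OF p c]
  have [measurable]: "p \<in> borel_measurable borel" by (rule p_props)
  have L1: "1 \<le> L" "p 2 \<le> L"
    using L by (auto simp: L_def)
  have a\<sigma>: "a / \<sigma> \<le> 2"
    using a \<sigma> by (simp add: divide_simps)
  have \<tau>0: "0 < \<tau>"
    using a \<sigma> p_props(3)[of 2] by (simp add: \<tau>)
  \<comment> \<open>This keeps \<open>l * L\<close> at most \<open>1/4\<close>, well inside the
    range where the Laplace moment generating function is finite and \<open>laplace_mgf_le\<close>
    applies.\<close>
  have \<tau>L: "\<tau> \<le> 2 * L"
    using mult_mono[OF L1(2) a\<sigma>] L1 a \<sigma> by (simp add: \<tau> mult.commute)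
  have l0: "0 < l"
    using \<tau>0 L1 by (simp add: l_def)
  have lL: "l * L \<le> 1 / 4"
    using \<tau>L L1 by (simp add: l_def field_simps power2_eq_square)
  have "l * 1 \<le> l * L"
    using l0 L1 by (intro mult_left_mono) auto
  then have l1: "l \<le> 1"
    using lL by linarith
  have [measurable]: "\<xi> i j \<in> borel_measurable M" "W i j \<in> borel_measurable M" if "i \<in> {1..n}" for i
    using distributed_measurable[OF lawX[OF that]] distributed_measurable[OF lawW[OF that]] by auto
  have [measurable]: "Y i \<in> borel_measurable M" if "i \<in> {1..n}" for i
    using that unfolding Y_def by measurable
  have sel: "selector_plus n \<tau> (privatized d \<alpha> (observation \<sigma> \<theta> \<xi>) W) j \<omega>
      = of_bool (real n * \<tau> \<le> (\<Sum>i=1..n. Y i \<omega>))" for \<omega>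
    using n by (simp add: selector_plus_def privatized_def observation_def Y_def L_def field_simps)
  show "err \<in> events"
    unfolding err_def sel by measurable
  define f where [abs_def]: "f x = e * l * sign_pm (\<theta> j + \<sigma> * x)" for x
  define g where [abs_def]: "g y = e * l * L * y" for y
  have [measurable]: "f \<in> borel_measurable borel" "g \<in> borel_measurable borel"
    unfolding f_def g_def by measurable
  \<comment> \<open>The factor \<open>1 - e\<close> is \<open>0\<close> off the support, where the
    sign has mean \<open>0\<close>, and \<open>2\<close> on it, where the mean is at least
    \<open>2 * \<tau>\<close>. One bound thus serves both cases.\<close>
  define A where "A = exp (l\<^sup>2 - (1 - e) * l * \<tau>)"
  define B where "B = exp (2 * (l * L)\<^sup>2)"
  have X_bound: "integrable M (\<lambda>\<omega>. exp (f (\<xi> i j \<omega>))) \<and> expectation (\<lambda>\<omega>. exp (f (\<xi> i j \<omega>))) \<le> A"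
    if i: "i \<in> {1..n}" for i
  proof -
    define m where "m = expectation (\<lambda>\<omega>. sign_pm (\<theta> j + \<sigma> * \<xi> i j \<omega>))"
    have m_eq: "m = (\<integral>x. p x * sign_pm (\<theta> j + \<sigma> * x) \<partial>lborel)"
      unfolding m_def
      by (rule distributed_integral[OF lawX[OF i], symmetric]) (auto intro: less_imp_le p_props)
    have int_p: "integrable lborel p"
      using distributed_integrable[OF lawX[OF i], of "\<lambda>_. 1"] p_props(3) by (simp add: less_imp_le)
    have int: "integrable M (\<lambda>\<omega>. sign_pm (\<theta> j + \<sigma> * \<xi> i j \<omega>))"
      using i by (intro integrable_const_bound[of _ 1]) (auto simp: sign_pm_def)
    have "exp (f x) = cosh (e * l) + sinh (e * l) * sign_pm (\<theta> j + \<sigma> * x)" for x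
      by (simp add: f_def exp_sign_pm)
    then have eq: "expectation (\<lambda>\<omega>. exp (f (\<xi> i j \<omega>))) = cosh (e * l) + sinh (e * l) * m"
      and int': "integrable M (\<lambda>\<omega>. exp (f (\<xi> i j \<omega>)))"
      using int by (simp_all add: m_def prob_space)
    have cosh_l: "cosh l \<le> 1 + l\<^sup>2"
      using l0 l1 by (intro cosh_le_one_plus_square) auto
    show ?thesis
    proof (cases "\<theta> j = 0")
      case True
      then have "m = 0"
        using integral_sign_symmetric[of p \<sigma>] p_props \<sigma> by (simp add: m_eq)
      then have "expectation (\<lambda>\<omega>. exp (f (\<xi> i j \<omega>))) \<le> 1 + l\<^sup>2"
        using cosh_l eq True by (simp add: e_def)
      also have "\<dots> \<le> A"
        using True by (simp add: A_def e_def)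
      finally show ?thesis using int' by simp
    next
      case False
      have "2 * \<tau> \<le> m"
        unfolding m_eq \<tau> using False \<theta> a \<sigma> p_props
        by (intro integral_sign_shift_ge int_p) (auto intro: less_imp_le)
      \<comment> \<open>Here \<open>e = -1\<close>, so the mean enters the moment generating
        function as \<open>- sinh l * m\<close>, and a lower bound on \<open>sinh l * m\<close> is
        what is needed.\<close>
      then have "l * (2 * \<tau>) \<le> sinh l * m"
        using le_sinh[of l] l0 \<tau>0 by (intro mult_mono) auto
      then have "expectation (\<lambda>\<omega>. exp (f (\<xi> i j \<omega>))) \<le> 1 + (l\<^sup>2 - (1 - e) * l * \<tau>)"
        using cosh_l eq False by (simp add: e_def)
      also have "\<dots> \<le> A"
        unfolding A_def by (rule exp_ge_add_one_self)
      finally show ?thesis using int' by simp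
    qed
  qed
  have W_bound: "integrable M (\<lambda>\<omega>. exp (g (W i j \<omega>))) \<and> expectation (\<lambda>\<omega>. exp (g (W i j \<omega>))) \<le> B"
    if i: "i \<in> {1..n}" for i
  proof -
    have u: "\<bar>e * l * L\<bar> < 1" "(e * l * L)\<^sup>2 = (l * L)\<^sup>2"
      using l0 L1 lL by (auto simp: e_def abs_mult power2_eq_square)
    have "(l * L)\<^sup>2 \<le> (1 / 4)\<^sup>2"
      using l0 L1 lL by (intro power_mono) auto
    then have small: "(l * L)\<^sup>2 \<le> 1 / 2"
      by (simp add: power2_eq_square)
    have lap: "has_bochner_integral lborel (\<lambda>x. laplace_density x * exp (g x)) (1 / (1 - (l * L)\<^sup>2))"
      using laplace_mgf[OF u(1)] unfolding u(2) g_def .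
    have "integrable M (\<lambda>\<omega>. exp (g (W i j \<omega>)))"
      using distributed_integrable[OF lawW[OF i], of "\<lambda>x. exp (g x)"] lap
      by (auto simp: laplace_density_def has_bochner_integral_iff)
    moreover have "expectation (\<lambda>\<omega>. exp (g (W i j \<omega>))) = 1 / (1 - (l * L)\<^sup>2)"
      using distributed_integral[OF lawW[OF i], of "\<lambda>x. exp (g x)"] lap
      by (auto simp: laplace_density_def has_bochner_integral_iff)
    ultimately show ?thesis
      using laplace_mgf_le[OF small] by (simp add: B_def)
  qed
  \<comment> \<open>Only column \<open>j\<close> enters the empirical mean; independence is
    restricted to it with the pairs kept as indices.\<close>
  have indep_j: "indep_vars (\<lambda>_. borel) (case_sum (\<lambda>(i, j). \<xi> i j) (\<lambda>(i, j). W i j))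
                  (({1..n} \<times> {j}) <+> ({1..n} \<times> {j}))"
    by (rule indep_vars_subset[OF indep]) (use j in auto)
  have sum_eq: "(\<Sum>ij\<in>{1..n} \<times> {j}. f ((\<lambda>(i, j). \<xi> i j) ij \<omega>) + g ((\<lambda>(i, j). W i j) ij \<omega>))
      = e * l * (\<Sum>i=1..n. Y i \<omega>)" for \<omega>
  proof -
    have "{1..n} \<times> {j} = (\<lambda>i. (i, j)) ` {1..n}" by auto
    then show ?thesis
      by (simp add: sum.reindex inj_on_def f_def g_def Y_def sum_distrib_left algebra_simps)
  qed
  \<comment> \<open>Off the support an error means that the sum reaches \<open>n * \<tau>\<close>,
    on it that the sum stays below. Multiplying by \<open>e * l\<close> turns both into the same
    upper-tail event.\<close>
  have "err \<subseteq> {\<omega> \<in> space M. e * l * (real n * \<tau>) \<le> e * l * (\<Sum>i=1..n. Y i \<omega>)}"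
    unfolding err_def sel using l0
    by (auto simp: support_pattern_def e_def mult_le_cancel_left_pos)
  then have "prob (err) \<le> prob {\<omega> \<in> space M. e * l * (real n * \<tau>) \<le> e * l * (\<Sum>i=1..n. Y i \<omega>)}"
    by (intro finite_measure_mono) measurable
  also have "\<dots> \<le> exp (- (e * l * (real n * \<tau>))) * (A * B) ^ card ({1..n} \<times> {j})"
    unfolding sum_eq[symmetric]
    by (rule chernoff_indep_sum[OF _ indep_j]) (use X_bound W_bound in auto)
  also have "\<dots> = exp (- (e * l * (real n * \<tau>)) + real n * (l\<^sup>2 - (1 - e) * l * \<tau> + 2 * (l * L)\<^sup>2))"
    by (simp add: A_def B_def mult_exp_exp flip: exp_of_nat_mult)
  \<comment> \<open>The threshold contributes \<open>- e * l * \<tau>\<close> and the mean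
    \<open>- (1 - e) * l * \<tau>\<close>, so \<open>e\<close> cancels and both cases leave the same
    exponent.\<close>
  also have "\<dots> = exp (real n * (l\<^sup>2 - l * \<tau> + 2 * (l * L)\<^sup>2))"
    by (simp add: algebra_simps)
  also have "\<dots> \<le> exp (- (real n * \<tau>\<^sup>2 / (128 * L\<^sup>2)))"
  proof -
    \<comment> \<open>Since \<open>L \<ge> 1\<close>, the variance term of the sign is absorbed into
      that of the Laplace noise. At the chosen \<open>l\<close> the total is
      \<open>3/64 - 8/64 = -5/64\<close> times \<open>\<tau>^2 / L^2\<close>.\<close>
    have "l\<^sup>2 * 1 \<le> l\<^sup>2 * L\<^sup>2"
      using L1 by (intro mult_left_mono) auto
    then have "l\<^sup>2 - l * \<tau> + 2 * (l * L)\<^sup>2 \<le> 3 * (l * L)\<^sup>2 - l * \<tau>"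
      by (simp add: power_mult_distrib mult.commute)
    also have "\<dots> = - (5 * \<tau>\<^sup>2 / (64 * L\<^sup>2))"
      using L1 by (simp add: l_def field_simps power2_eq_square)
    also have "\<dots> \<le> - (\<tau>\<^sup>2 / (128 * L\<^sup>2))"
      using L1 by (simp add: field_simps)
    finally have "real n * (l\<^sup>2 - l * \<tau> + 2 * (l * L)\<^sup>2) \<le> real n * - (\<tau>\<^sup>2 / (128 * L\<^sup>2))"
      by (rule mult_left_mono) simp
    then show ?thesis by simp
  qed
  finally show "prob (err) \<le> exp (- (real n * \<tau>\<^sup>2 / (128 * (2 * real d / \<alpha>)\<^sup>2)))"
    by (simp add: L_def)
qed

section \<open>The risk as a sum over coordinates, and the parameter set\<close>

lemma (in prob_space) selector_risk_eq_sum: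
  assumes "\<And>j. j \<in> {1..d} \<Longrightarrow>
    {\<omega> \<in> space M. selector_plus n \<tau> (privatized d \<alpha> (observation \<sigma> \<theta> \<xi>) W) j \<omega>
                     \<noteq> support_pattern \<theta> j} \<in> events"
  shows "selector_risk M d n \<alpha> \<sigma> \<tau> \<xi> W \<theta> =
    (\<Sum>j=1..d. prob {\<omega> \<in> space M. selector_plus n \<tau> (privatized d \<alpha> (observation \<sigma> \<theta> \<xi>) W) j \<omega>
                                     \<noteq> support_pattern \<theta> j})" (is "_ = (\<Sum>j=1..d. prob (?E j))")
proof -
  have "selector_risk M d n \<alpha> \<sigma> \<tau> \<xi> W \<theta> = expectation (\<lambda>\<omega>. \<Sum>j=1..d. indicator (?E j) \<omega>)"
    unfolding selector_risk_def hamming_def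
    by (intro Bochner_Integration.integral_cong refl) (auto simp del: sum_of_bool_eq intro!: sum.cong split: split_indicator)
  also have "\<dots> = (\<Sum>j=1..d. expectation (indicator (?E j)))"
    using assms by (intro Bochner_Integration.integral_sum) (auto intro!: integrable_real_indicator simp: emeasure_eq_measure)
  also have "\<dots> = (\<Sum>j=1..d. prob (?E j))"
    using assms by (intro sum.cong) auto
  finally show ?thesis .
qed

lemma selector_risk_nonneg: "0 \<le> selector_risk M d n \<alpha> \<sigma> \<tau> \<xi> W \<theta>"
  unfolding selector_risk_def by (intro Bochner_Integration.integral_nonneg) simp

text \<open>The zero vector, with empty support, is a member. This makes the real-valued supremum
  meaningful.\<close>

lemma Theta_plus_nonempty: "Theta_plus d s a \<noteq> {}"
proof -
  have "(\<lambda>j\<in>{1..d}. 0) \<in> Theta_plus d s a"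
    by (auto simp: Theta_plus_def intro: exI[of _ "{}"])
  then show ?thesis by blast
qed

lemma Theta_plus_cases: "\<theta> \<in> Theta_plus d s a \<Longrightarrow> j \<in> {1..d} \<Longrightarrow> \<theta> j = 0 \<or> a \<le> \<theta> j"
  unfolding Theta_plus_def by auto

section \<open>Asymptotic comparison of the rates\<close>

text \<open>Turns the extended-real quotient into a real inequality. Where \<open>g d = 0\<close>
  the quotient carries no information, but the claim reduces to \<open>0 \<le> f d\<close>.\<close>

lemma much_greaterD:
  assumes "f \<ggreater> g" and "\<forall>\<^sub>F d in sequentially. 0 \<le> f d" and "\<forall>\<^sub>F d in sequentially. 0 \<le> g d"
  shows "\<forall>\<^sub>F d in sequentially. K * g d \<le> f d"
proof -
  have "\<forall>\<^sub>F d in sequentially. ereal K < ereal (f d) / ereal (g d)"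
    using assms(1) unfolding much_greater_def tendsto_PInfty by blast
  then show ?thesis
    using assms(2,3)
  proof eventually_elim
    case (elim d)
    show ?case
    proof (cases "g d = 0")
      case False
      with elim have "K < f d / g d" "0 < g d" by auto
      then show ?thesis by (simp add: field_simps)
    qed (use elim in simp)
  qed
qed

text \<open>Half of \<open>k * (x d)^2\<close> absorbs \<open>l d\<close> and the other half tends
  to infinity. Divergence of \<open>x\<close> is a separate hypothesis because \<open>dom\<close>
  does not yield it when \<open>l\<close> vanishes.\<close>

lemma exp_rate_tendsto_0:
  fixes x l :: "nat \<Rightarrow> real"
  assumes k: "0 < k" and x: "filterlim x at_top sequentially"
    and l: "\<forall>\<^sub>F d in sequentially. 0 \<le> l d"
    and dom: "\<And>K. \<forall>\<^sub>F d in sequentially. K * sqrt (l d) \<le> x d"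
  shows "(\<lambda>d. 2 * exp (l d - k * (x d)\<^sup>2)) \<longlonglongrightarrow> 0"
proof (rule tendsto_sandwich[where f = "\<lambda>_. 0" and h = "\<lambda>d. 2 * exp (- (k / 2 * (x d)\<^sup>2))"])
  have "filterlim (\<lambda>d. k / 2 * (x d)\<^sup>2) at_top sequentially"
    using k by (intro filterlim_tendsto_pos_mult_at_top[OF tendsto_const] filterlim_pow_at_top x) auto
  then have "(\<lambda>d. exp (- (k / 2 * (x d)\<^sup>2))) \<longlonglongrightarrow> 0"
    by (intro filterlim_compose[OF exp_at_bot])
      (rule filterlim_compose[OF filterlim_uminus_at_bot_at_top])
  then show "(\<lambda>d. 2 * exp (- (k / 2 * (x d)\<^sup>2))) \<longlonglongrightarrow> 0"
    by (rule tendsto_mult_right_zero)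
  show "\<forall>\<^sub>F d in sequentially. 2 * exp (l d - k * (x d)\<^sup>2) \<le> 2 * exp (- (k / 2 * (x d)\<^sup>2))"
    \<comment> \<open>Squaring the domination with this constant gives
      \<open>l d \<le> k / 2 * (x d)^2\<close>.\<close>
    using dom[of "sqrt (2 / k)"] l
  proof eventually_elim
    case (elim d)
    have "(sqrt (2 / k) * sqrt (l d))\<^sup>2 \<le> (x d)\<^sup>2"
      using elim k by (intro power_mono) auto
    then have "l d \<le> k / 2 * (x d)\<^sup>2"
      using elim k by (simp add: power_mult_distrib field_simps)
    then show ?case by simp
  qed
qed auto

section \<open>The uniform risk bound and the two limits\<close>

theorem corollary2p7:
  fixes M :: "nat \<Rightarrow> 'w measure"
    and \<xi> W :: "nat \<Rightarrow> nat \<Rightarrow> nat \<Rightarrow> 'w \<Rightarrow> real"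
    and p :: "real \<Rightarrow> real"
    and c \<sigma> :: real
    and n s :: "nat \<Rightarrow> nat"
    and \<alpha> a :: "nat \<Rightarrow> real"
  assumes c_pos: "c > 0"
    and sigma_pos: "\<sigma> > 0"
    and log_concave: "symmetric_strongly_log_concave c p"
    and p_prob: "prob_space (density lborel p)"
    and p_variance: "prob_space.variance (density lborel p) (\<lambda>x. x) = 1"
    and prob: "\<And>d. d \<ge> 1 \<Longrightarrow> prob_space (M d)"
    and noise_law: "\<And>d i j. d \<ge> 1 \<Longrightarrow> i \<in> {1..n d} \<Longrightarrow> j \<in> {1..d} \<Longrightarrow>
                      distributed (M d) lborel (\<xi> d i j) p"
    and laplace_law: "\<And>d i j. d \<ge> 1 \<Longrightarrow> i \<in> {1..n d} \<Longrightarrow> j \<in> {1..d} \<Longrightarrow>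
                      distributed (M d) lborel (W d i j) laplace_density"
    and indep: "\<And>d. d \<ge> 1 \<Longrightarrow>
                  prob_space.indep_vars (M d) (\<lambda>_. borel)
                    (case_sum (\<lambda>(i, j). \<xi> d i j) (\<lambda>(i, j). W d i j))
                    (({1..n d} \<times> {1..d}) <+> ({1..n d} \<times> {1..d}))"
    and n_pos: "\<And>d. d \<ge> 1 \<Longrightarrow> n d \<ge> 1"
    and alpha_pos: "\<And>d. d \<ge> 1 \<Longrightarrow> \<alpha> d > 0"
    and s_range: "\<And>d. d \<ge> 1 \<Longrightarrow> 1 \<le> s d \<and> s d \<le> d"
    and a_pos: "\<And>d. d \<ge> 1 \<Longrightarrow> a d > 0"
    and alpha_lim: "(\<lambda>d. \<alpha> d / real d) \<longlonglongrightarrow> 0"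
    and n_alpha_lim: "filterlim (\<lambda>d. real (n d) * (\<alpha> d)\<^sup>2 / (real d)\<^sup>2) at_top sequentially"
    and a_lower: "a \<ggreater> (\<lambda>d. \<sigma> * real d / (sqrt (real (n d)) * \<alpha> d))"
    and a_upper: "\<forall>\<^sub>F d in sequentially. a d \<le> 2 * \<sigma>"
  shows "(\<forall>\<^sub>F d in sequentially.
            (SUP \<theta>\<in>Theta_plus d (s d) (a d).
               (1 / real (s d)) *
               selector_risk (M d) d (n d) (\<alpha> d) \<sigma> (p 2 * a d / \<sigma>) (\<xi> d) (W d) \<theta>)
            \<le> 2 * exp (ln (real d / real (s d))
                 - (p 2)\<^sup>2 * (a d)\<^sup>2 * real (n d) * (\<alpha> d)\<^sup>2 / (2 ^ 9 * \<sigma>\<^sup>2 * (real d)\<^sup>2)))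
       \<and> (a \<ggreater> (\<lambda>d. \<sigma> * real d / (\<alpha> d * sqrt (real (n d))) * sqrt (ln (real d / real (s d)))) \<longrightarrow>
            (\<lambda>d. SUP \<theta>\<in>Theta_plus d (s d) (a d).
               (1 / real (s d)) *
               selector_risk (M d) d (n d) (\<alpha> d) \<sigma> (p 2 * a d / \<sigma>) (\<xi> d) (W d) \<theta>)
            \<longlonglongrightarrow> 0)
       \<and> (a \<ggreater> (\<lambda>d. \<sigma> * real d / (\<alpha> d * sqrt (real (n d))) * sqrt (ln (real d))) \<longrightarrow>
            (\<lambda>d. SUP \<theta>\<in>Theta_plus d (s d) (a d).
               selector_risk (M d) d (n d) (\<alpha> d) \<sigma> (p 2 * a d / \<sigma>) (\<xi> d) (W d) \<theta>)
            \<longlonglongrightarrow> 0)"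
proof -
  define risk where "risk d \<theta> =
    selector_risk (M d) d (n d) (\<alpha> d) \<sigma> (p 2 * a d / \<sigma>) (\<xi> d) (W d) \<theta>" for d \<theta>
  define k where "k = (p 2)\<^sup>2 / 2 ^ 9"
  \<comment> \<open>\<open>x d\<close> is the ratio of \<open>a d\<close> to the basic rate
    \<open>\<sigma> * d / (sqrt n * \<alpha>)\<close>; every growth condition on \<open>a\<close>
    becomes one on \<open>x\<close>, and the exponent is \<open>k * (x d)^2\<close>.\<close>
  define x where "x d = a d * sqrt (real (n d)) * \<alpha> d / (\<sigma> * real d)" for d
  have rate: "(p 2)\<^sup>2 * (a d)\<^sup>2 * real (n d) * (\<alpha> d)\<^sup>2 / (2 ^ 9 * \<sigma>\<^sup>2 * (real d)\<^sup>2) = k * (x d)\<^sup>2" for d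
    by (simp add: k_def x_def power_mult_distrib power_divide)
  have p2: "0 < p 2"
    using symmetric_strongly_log_concaveD(3)[OF log_concave c_pos] .
  then have k: "0 < k" by (simp add: k_def)

  \<comment> \<open>Inverted, this says that the noise scale \<open>2 * d / \<alpha> d\<close>
    exceeds both \<open>1\<close> and \<open>p 2\<close>, as the coordinatewise bound
    requires.\<close>
  have "\<forall>\<^sub>F d in sequentially. \<alpha> d / real d < 2 / max 1 (p 2)"
    using alpha_lim by (rule order_tendstoD) simp
  then have risk_le: "\<forall>\<^sub>F d in sequentially. 1 \<le> d \<and>
      (\<forall>\<theta>\<in>Theta_plus d (s d) (a d). risk d \<theta> \<le> real d * exp (- (k * (x d)\<^sup>2)))"
    using a_upper eventually_ge_at_top[of 1]
  proof eventually_elim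
    case (elim d)
    interpret prob_space "M d"
      using elim by (intro prob)
    have "m \<le> 2 * D / b" if "b / D < 2 / m" "0 < m" "0 < D" "0 < b" for m D b :: real
      using that by (simp add: field_simps)
    from this[of "\<alpha> d" "real d" "max 1 (p 2)"] have "max 1 (p 2) \<le> 2 * real d / \<alpha> d"
      using elim alpha_pos[of d] by (simp del: max.bounded_iff)
    then have L: "1 \<le> 2 * real d / \<alpha> d" "p 2 \<le> 2 * real d / \<alpha> d"
      by auto
    have "risk d \<theta> \<le> real d * exp (- (k * (x d)\<^sup>2))" if \<theta>: "\<theta> \<in> Theta_plus d (s d) (a d)" for \<theta>
    proof -
      note err = coordinate_error[OF log_concave c_pos sigma_pos noise_law laplace_law indep
          n_pos _ a_pos _ L Theta_plus_cases[OF \<theta>] refl]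
      have "risk d \<theta> \<le> (\<Sum>j=1..d. exp (- (real (n d) * (p 2 * a d / \<sigma>)\<^sup>2 / (128 * (2 * real d / \<alpha> d)\<^sup>2))))"
        unfolding risk_def
      proof (subst selector_risk_eq_sum)
        show "{\<omega> \<in> space (M d). selector_plus (n d) (p 2 * a d / \<sigma>)
            (privatized d (\<alpha> d) (observation \<sigma> \<theta> (\<xi> d)) (W d)) j \<omega> \<noteq> support_pattern \<theta> j} \<in> events"
          if "j \<in> {1..d}" for j
          using elim that by (intro err) auto
      qed (use elim in \<open>intro sum_mono err; simp\<close>)
      \<comment> \<open>The constant \<open>2 ^ 9\<close> of \<open>k\<close> arises as
        \<open>128 * 2^2\<close>, the square coming from the noise scale.\<close>
      also have "real (n d) * (p 2 * a d / \<sigma>)\<^sup>2 / (128 * (2 * real d / \<alpha> d)\<^sup>2) = k * (x d)\<^sup>2"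
        using elim alpha_pos[of d] sigma_pos
        by (simp add: k_def x_def power_mult_distrib power_divide mult_ac)
      finally show ?thesis by simp
    qed
    with elim show ?case by simp
  qed

  \<comment> \<open>The weight \<open>w\<close> treats both normalisations at once:
    \<open>w d = 1 / s d\<close> produces \<open>ln (d / s)\<close> and \<open>w d = 1\<close>
    produces \<open>ln d\<close>. The lower bound \<open>0\<close> is for the squeeze argument; the
    factor \<open>2\<close> is slack.\<close>
  have sup_le: "\<forall>\<^sub>F d in sequentially. 0 \<le> (SUP \<theta>\<in>Theta_plus d (s d) (a d). w d * risk d \<theta>) \<and>
      (SUP \<theta>\<in>Theta_plus d (s d) (a d). w d * risk d \<theta>) \<le> 2 * exp (ln (real d * w d) - k * (x d)\<^sup>2)"
    if w: "\<And>d. 1 \<le> d \<Longrightarrow> 0 < w d" for w :: "nat \<Rightarrow> real"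
    using risk_le
  proof eventually_elim
    case (elim d)
    then have wd: "0 < w d" and d: "0 < real d" using w[of d] by auto
    have bound: "w d * risk d \<theta> \<le> 2 * exp (ln (real d * w d) - k * (x d)\<^sup>2)"
      if "\<theta> \<in> Theta_plus d (s d) (a d)" for \<theta>
    proof -
      have "w d * risk d \<theta> \<le> w d * (real d * exp (- (k * (x d)\<^sup>2)))"
        using elim that wd by (intro mult_left_mono) auto
      also have "\<dots> = exp (ln (real d * w d) - k * (x d)\<^sup>2)"
        using wd d by (simp add: exp_diff exp_minus field_simps)
      finally show ?thesis
        by (smt (verit) exp_gt_zero)
    qed
    obtain \<theta> where \<theta>: "\<theta> \<in> Theta_plus d (s d) (a d)"
      using Theta_plus_nonempty by blast
    have "0 \<le> w d * risk d \<theta>"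
      using wd by (simp add: risk_def selector_risk_nonneg)
    \<comment> \<open>A real supremum dominates its members only for sets bounded above, which
      \<open>bound\<close> supplies.\<close>
    then have "0 \<le> (SUP \<theta>\<in>Theta_plus d (s d) (a d). w d * risk d \<theta>)"
      using \<theta> bound by (intro cSUP_upper2[of _ _ \<theta>] bdd_aboveI2)
    with bound show ?case
      by (auto intro!: cSUP_least Theta_plus_nonempty)
  qed

  have a_pos_ev: "\<forall>\<^sub>F d in sequentially. 0 \<le> a d"
    using eventually_ge_at_top[of 1] by eventually_elim (use a_pos in \<open>auto intro: less_imp_le\<close>)
  have x_ge: "\<forall>\<^sub>F d in sequentially. K * r d \<le> x d"
    if "a \<ggreater> (\<lambda>d. \<sigma> * real d / (\<alpha> d * sqrt (real (n d))) * r d)" and "\<forall>\<^sub>F d in sequentially. 0 \<le> r d"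
    for r :: "nat \<Rightarrow> real" and K
  proof -
    have "\<forall>\<^sub>F d in sequentially. 0 \<le> \<sigma> * real d / (\<alpha> d * sqrt (real (n d))) * r d"
      using that(2) eventually_ge_at_top[of 1]
      by eventually_elim (simp add: sigma_pos alpha_pos less_imp_le)
    from much_greaterD[OF that(1) a_pos_ev this, of K] eventually_ge_at_top[of 1]
    show ?thesis
    proof eventually_elim
      case (elim d)
      have "0 < \<alpha> d" "0 < real (n d)" "0 < real d"
        using elim alpha_pos[of d] n_pos[of d] by auto
      with elim sigma_pos show ?case
        by (simp add: x_def field_simps)
    qed
  qed
  \<comment> \<open>With \<open>r = 1\<close> the lower growth condition on \<open>a\<close> gives
    \<open>K \<le> x d\<close> eventually for every \<open>K\<close>.\<close>
  have x_top: "filterlim x at_top sequentially"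
    unfolding filterlim_at_top using x_ge[of "\<lambda>_. 1"] a_lower by (simp add: mult.commute)

  \<comment> \<open>The condition \<open>1 \<le> real d * w d\<close> makes the logarithm
    nonnegative, so that its square root is a genuine rate; for \<open>w d = 1 / s d\<close> it is
    \<open>s d \<le> d\<close>.\<close>
  have sup_tendsto_0: "(\<lambda>d. SUP \<theta>\<in>Theta_plus d (s d) (a d). w d * risk d \<theta>) \<longlonglongrightarrow> 0"
    if w: "\<And>d. 1 \<le> d \<Longrightarrow> 0 < w d \<and> 1 \<le> real d * w d"
      and dom: "a \<ggreater> (\<lambda>d. \<sigma> * real d / (\<alpha> d * sqrt (real (n d))) * sqrt (ln (real d * w d)))"
    for w :: "nat \<Rightarrow> real"
  proof -
    have ln_nonneg: "\<forall>\<^sub>F d in sequentially. 0 \<le> ln (real d * w d)"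
      using eventually_ge_at_top[of 1] by eventually_elim (use w in auto)
    then have "\<forall>\<^sub>F d in sequentially. 0 \<le> sqrt (ln (real d * w d))"
      by eventually_elim simp
    from x_ge[OF dom this]
    have lim: "(\<lambda>d. 2 * exp (ln (real d * w d) - k * (x d)\<^sup>2)) \<longlonglongrightarrow> 0"
      by (intro exp_rate_tendsto_0 k x_top ln_nonneg)
    show ?thesis
      using sup_le[of w] w
      by (intro tendsto_sandwich[OF _ _ tendsto_const lim]) (simp_all add: eventually_conj_iff)
  qed
  have s: "0 < 1 / real (s d) \<and> 1 \<le> real d * (1 / real (s d))" if "1 \<le> d" for d
    using s_range[OF that] by (simp add: divide_simps)
  have "\<forall>\<^sub>F d in sequentially. (SUP \<theta>\<in>Theta_plus d (s d) (a d). (1 / real (s d)) * risk d \<theta>)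
      \<le> 2 * exp (ln (real d / real (s d)) - k * (x d)\<^sup>2)"
    using sup_le[of "\<lambda>d. 1 / real (s d)"] s by (simp add: eventually_conj_iff)
  moreover have "(\<lambda>d. SUP \<theta>\<in>Theta_plus d (s d) (a d). (1 / real (s d)) * risk d \<theta>) \<longlonglongrightarrow> 0"
    if "a \<ggreater> (\<lambda>d. \<sigma> * real d / (\<alpha> d * sqrt (real (n d))) * sqrt (ln (real d / real (s d))))"
    using sup_tendsto_0[OF s] that by simp
  moreover have "(\<lambda>d. SUP \<theta>\<in>Theta_plus d (s d) (a d). risk d \<theta>) \<longlonglongrightarrow> 0"
    if "a \<ggreater> (\<lambda>d. \<sigma> * real d / (\<alpha> d * sqrt (real (n d))) * sqrt (ln (real d)))"
    using sup_tendsto_0[of "\<lambda>_. 1"] that by simp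
  ultimately show ?thesis
    unfolding risk_def rate by blast
qed

end
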